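(* Let $L\ge1$ be an integer. The zeros of $$A_L(x)=\frac{d^L}{dx^L}\frac{x}{(x^2+1)^{3/2}}\qquad\text{and}\qquad B_L(x)=\frac{d^L}{dx^L}\frac{1}{(x^2+1)^{3/2}}$$ strictly interlace. Equivalently, the zeros of the polynomials $P_L(x)=(1+x^2)^{(2L+3)/2}A_L(x)$ and $Q_L(x)=(1+x^2)^{(2L+3)/2}B_L(x)$ strictly interlace.
   Context: $P_L$ and $Q_L$ are polynomials of degree $L+1$ and $L$, respectively. That the zeros of $P_L$ and $Q_L$ (equivalently the real zeros of $A_L$ and $B_L$) strictly interlace means that they have no common zero and that there is exactly one zero of $Q_L$ strictly between any two consecutive real zeros of $P_L$. *)

theory Defs
  imports "HOL-Analysis.Analysis" "HOL-Computational_Algebra.Polynomial"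
begin

definition A :: "nat \<Rightarrow> real \<Rightarrow> real" where
  "A L = (deriv ^^ L) (\<lambda>x. x / (x\<^sup>2 + 1) powr (3 / 2))"

definition B :: "nat \<Rightarrow> real \<Rightarrow> real" where
  "B L = (deriv ^^ L) (\<lambda>x. 1 / (x\<^sup>2 + 1) powr (3 / 2))"

definition P :: "nat \<Rightarrow> real \<Rightarrow> real" where
  "P L x = (1 + x\<^sup>2) powr ((2 * real L + 3) / 2) * A L x"

definition Q :: "nat \<Rightarrow> real \<Rightarrow> real" where
  "Q L x = (1 + x\<^sup>2) powr ((2 * real L + 3) / 2) * B L x"

definition consecutive_zeros :: "(real \<Rightarrow> real) \<Rightarrow> real \<Rightarrow> real \<Rightarrow> bool" where
  "consecutive_zeros f a b \<longleftrightarrow>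
     a < b \<and> f a = 0 \<and> f b = 0 \<and> (\<forall>x. a < x \<and> x < b \<longrightarrow> f x \<noteq> 0)"

text \<open>Not symmetric: \<open>f\<close> is the function with the larger number of zeros.
  Only real zeros are considered.\<close>

definition strictly_interlace :: "(real \<Rightarrow> real) \<Rightarrow> (real \<Rightarrow> real) \<Rightarrow> bool" where
  "strictly_interlace f g \<longleftrightarrow>
     (\<nexists>x. f x = 0 \<and> g x = 0) \<and>
     (\<forall>a b. consecutive_zeros f a b \<longrightarrow> (\<exists>!x. a < x \<and> x < b \<and> g x = 0))"

end

theory Submission
  imports Defs
begin

text \<open>
  Write \<open>s = 1 + x\<^sup>2\<close>. By Leibniz' rule \<open>A\<^sub>n = x B\<^sub>n + n B\<^sub>n\<^sub>-\<^sub>1\<close>, and differentiation turns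
  \<open>A\<^sub>n\<close>, \<open>B\<^sub>n\<close> into \<open>A\<^sub>n\<^sub>+\<^sub>1\<close>, \<open>B\<^sub>n\<^sub>+\<^sub>1\<close>, so the Wronskian collapses to a Turan-type determinant:
  \<open>A\<^sub>n' B\<^sub>n - A\<^sub>n B\<^sub>n' = (n + 1) B\<^sub>n\<^sup>2 - n B\<^sub>n\<^sub>-\<^sub>1 B\<^sub>n\<^sub>+\<^sub>1\<close>.
  If it never vanishes, the zeros interlace: \<open>A\<^sub>n\<close> and \<open>B\<^sub>n\<close> have no common zero, and Rolle's theorem
  for \<open>A\<^sub>n / B\<^sub>n\<close> and for \<open>B\<^sub>n / A\<^sub>n\<close> puts a zero of either function strictly between any two zeros
  of the other (\<open>strictly_interlace_if_Wronskian_nonzero\<close>).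

  To see that the determinant is positive, write \<open>B\<^sub>n\<close> as a polynomial
  \<open>q\<^sub>n\<close> divided by the \<open>(2n + 3)\<close>-th power of \<open>\<surd>s\<close>. The
  polynomials \<open>q\<^sub>n\<close> are Gegenbauer polynomials of parameter \<open>3/2\<close> in disguise:
  with \<open>t = -x / \<surd>s\<close>, expanding \<open>(1 + (x + h)\<^sup>2)\<close> to the power
  \<open>-3/2\<close> in \<open>h\<close> shows that \<open>q\<^sub>n\<close> is \<open>n!\<close> times the
  \<open>n\<close>-th power of \<open>\<surd>s\<close> times the \<open>n\<close>-th Gegenbauer polynomial at
  \<open>t\<close>. Thus they satisfy a three-term recurrence. For \<open>T\<^sub>n = (n + 1)
  q\<^sub>n\<^sup>2 - n q\<^sub>n\<^sub>-\<^sub>1 q\<^sub>n\<^sub>+\<^sub>1\<close> a plain induction on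
  \<open>T\<^sub>n > 0\<close> fails: for the Gegenbauer values, the recurrence expresses the determinant as a
  positive multiple of the previous one plus a positive multiple of a difference of two consecutive squares.
  Summation by parts absorbs the negative square, and shows that the excess \<open>(2n + 1) T\<^sub>n -
  q\<^sub>n\<^sup>2\<close> is the quantity that propagates with nonnegative coefficients
  (\<open>excess_Suc\<close>).
\<close>

section \<open>Interlacing from a nonvanishing Wronskian\<close>

text \<open>Otherwise \<open>f / g\<close> would be differentiable on \<open>[a, b]\<close> with equal values at the ends, and its
  derivative is the Wronskian divided by \<open>g\<^sup>2\<close>.\<close>

lemma zero_between_if_Wronskian_nonzero:
  fixes f g f' g' :: "real \<Rightarrow> real"
  assumes f: "\<And>x. (f has_real_derivative f' x) (at x)"
    and g: "\<And>x. (g has_real_derivative g' x) (at x)"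
    and W: "\<And>x. f' x * g x - f x * g' x \<noteq> 0"
    and ab: "a < b" "f a = 0" "f b = 0"
  shows "\<exists>x. a < x \<and> x < b \<and> g x = 0"
proof (rule ccontr)
  assume no_zero: "\<not> ?thesis"
  have "g a \<noteq> 0" "g b \<noteq> 0"
    using W[of a] W[of b] ab by auto
  with no_zero have g0: "g x \<noteq> 0" if "a \<le> x" "x \<le> b" for x
    using that by (metis order_le_less)
  have der: "((\<lambda>x. f x / g x) has_real_derivative (f' x * g x - f x * g' x) / (g x * g x)) (at x)"
    if "a \<le> x" "x \<le> b" for x
    using f g g0[OF that] by (rule DERIV_divide)
  have "\<exists>z. a < z \<and> z < b \<and> (*) ((f' z * g z - f z * g' z) / (g z * g z)) = (\<lambda>v. 0)"
  proof (rule Rolle_deriv[OF ab(1)])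
    show "f a / g a = f b / g b" using ab by simp
    show "continuous_on {a..b} (\<lambda>x. f x / g x)"
      using der by (intro DERIV_continuous_on) (auto intro: has_field_derivative_at_within)
    show "((\<lambda>x. f x / g x) has_derivative (*) ((f' x * g x - f x * g' x) / (g x * g x))) (at x)"
      if "a < x" "x < b" for x
      using der[of x] that by (simp add: has_field_derivative_def)
  qed
  then obtain z where "a < z" "z < b" "(f' z * g z - f z * g' z) / (g z * g z) = 0"
    by (metis mult.right_neutral)
  then show False using W[of z] g0[of z] by simp
qed

lemma strictly_interlace_if_Wronskian_nonzero:
  fixes f g f' g' :: "real \<Rightarrow> real"
  assumes f: "\<And>x. (f has_real_derivative f' x) (at x)"
    and g: "\<And>x. (g has_real_derivative g' x) (at x)"
    and W: "\<And>x. f' x * g x - f x * g' x \<noteq> 0"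
  shows "strictly_interlace f g"
  unfolding strictly_interlace_def
proof (intro conjI allI impI)
  show "\<nexists>x. f x = 0 \<and> g x = 0"
    by (metis W diff_self mult_zero_left mult_zero_right)
next
  fix a b assume ab: "consecutive_zeros f a b"
  have W': "g' x * f x - g x * f' x \<noteq> 0" for x
    using W[of x] by (simp add: mult.commute)
  have "\<exists>x. a < x \<and> x < b \<and> g x = 0"
    using zero_between_if_Wronskian_nonzero[OF f g W] ab by (auto simp: consecutive_zeros_def)
  moreover have False if "a < x" "x < y" "y < b" "g x = 0" "g y = 0" for x y
  proof -
    obtain z where "x < z" "z < y" "f z = 0"
      using zero_between_if_Wronskian_nonzero[OF g f W'] \<open>x < y\<close> \<open>g x = 0\<close> \<open>g y = 0\<close> by blast
    then show False
      using ab that by (auto simp: consecutive_zeros_def)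
  qed
  ultimately show "\<exists>!x. a < x \<and> x < b \<and> g x = 0"
    by (metis linorder_neqE)
qed

lemma strictly_interlace_cong_zeros:
  assumes "\<And>x. f x = 0 \<longleftrightarrow> f' x = 0" "\<And>x. g x = 0 \<longleftrightarrow> g' x = 0"
  shows "strictly_interlace f g \<longleftrightarrow> strictly_interlace f' g'"
  using assms by (simp add: strictly_interlace_def consecutive_zeros_def)

section \<open>The numerator polynomials\<close>

text \<open>The numerator of \<open>B\<^sub>n\<close>. The truncated index \<open>n - 1\<close> is harmless at \<open>n = 0\<close>, where its
  coefficient vanishes; this keeps all identities below free of case distinctions.\<close>

fun q_poly :: "nat \<Rightarrow> real poly" where
  "q_poly 0 = 1"
| "q_poly (Suc n) = - smult (2 * real n + 3) ([:0, 1:] * q_poly n)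
     - smult (real n * (real n + 2)) ([:1, 0, 1:] * q_poly (n - 1))"

definition p_poly :: "nat \<Rightarrow> real poly" where
  "p_poly n = [:0, 1:] * q_poly n + smult (real n) ([:1, 0, 1:] * q_poly (n - 1))"

lemma poly_q_poly_Suc:
  "poly (q_poly (Suc n)) x = - (2 * real n + 3) * x * poly (q_poly n) x
     - real n * (real n + 2) * (1 + x\<^sup>2) * poly (q_poly (n - 1)) x"
  by (simp add: power2_eq_square algebra_simps)

text \<open>Differentiating \<open>B\<^sub>n\<close> gives \<open>q\<^sub>n\<^sub>+\<^sub>1 = (1 + x\<^sup>2) q\<^sub>n' - (2n + 3) x q\<^sub>n\<close>. Comparison with the
  three-term recurrence shows what \<open>q\<^sub>n'\<close> has to be; the induction differentiates the three-term
  recurrence.\<close>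

lemma pderiv_q_poly: "pderiv (q_poly n) = - smult (real n * (real n + 2)) (q_poly (n - 1))"
proof (induction n rule: less_induct)
  case (less n)
  show ?case
  proof (cases n)
    case 0
    then show ?thesis by simp
  next
    case (Suc m)
    have IH: "poly (pderiv (q_poly m)) x = - (real m * (real m + 2) * poly (q_poly (m - 1)) x)" for x
      using less.IH[of m] Suc by simp
    have IH': "real m * poly (pderiv (q_poly (m - 1))) x
        = - (real m * (real m - 1) * (real m + 1) * poly (q_poly (m - 1 - 1)) x)" for x
      using less.IH[of "m - 1"] Suc by (cases m) (auto simp: algebra_simps)
    have rec: "real m * poly (q_poly m) x = real m * (- (2 * real m + 1) * x * poly (q_poly (m - 1)) x
        - (real m - 1) * (real m + 1) * (1 + x\<^sup>2) * poly (q_poly (m - 1 - 1)) x)" for x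
    proof (cases m)
      case (Suc k)
      then show ?thesis
        using poly_q_poly_Suc[of k x] by (simp add: algebra_simps)
    qed simp
    have "poly (pderiv (q_poly n)) x = poly (- smult (real n * (real n + 2)) (q_poly (n - 1))) x" for x
    proof -
      have "poly (pderiv (q_poly n)) x =
          - (2 * real m + 3) * (poly (q_poly m) x + x * poly (pderiv (q_poly m)) x)
          - (real m + 2) * (2 * x * (real m * poly (q_poly (m - 1)) x)
             + (1 + x\<^sup>2) * (real m * poly (pderiv (q_poly (m - 1))) x))"
        by (simp add: Suc pderiv_add pderiv_diff pderiv_minus pderiv_smult pderiv_mult pderiv_pCons
            power2_eq_square algebra_simps)
      also have "\<dots> = - (2 * real m + 3) * poly (q_poly m) x
          + (real m + 2) * (real m * ((2 * real m + 1) * x * poly (q_poly (m - 1)) x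
              + (real m - 1) * (real m + 1) * (1 + x\<^sup>2) * poly (q_poly (m - 1 - 1)) x))"
        unfolding IH IH' by (simp add: algebra_simps)
      also have "\<dots> = - (2 * real m + 3) * poly (q_poly m) x
          - (real m + 2) * (real m * poly (q_poly m) x)"
        unfolding rec by (simp add: algebra_simps)
      also have "\<dots> = poly (- smult (real n * (real n + 2)) (q_poly (n - 1))) x"
        using Suc by (simp add: algebra_simps)
      finally show ?thesis .
    qed
    then show ?thesis
      by (intro iffD1[OF poly_eq_poly_eq_iff] ext)
  qed
qed

lemma q_poly_Suc_pderiv:
  "q_poly (Suc n) = [:1, 0, 1:] * pderiv (q_poly n) - smult (2 * real n + 3) ([:0, 1:] * q_poly n)"
  by (simp add: pderiv_q_poly algebra_simps)

text \<open>In the top coefficient the recurrence through the derivative has only two contributions,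
  \<open>n\<close> from the derivative and \<open>-(2n + 3)\<close>, so each step multiplies it by \<open>-(n + 3)\<close>.\<close>

lemma q_poly_degree_coeff:
  "degree (q_poly n) \<le> n \<and> coeff (q_poly n) n = (- 1) ^ n * fact (n + 2) / 2"
proof (induction n)
  case 0
  then show ?case by (simp add: numeral_2_eq_2)
next
  case (Suc n)
  then have deg: "degree (q_poly n) \<le> n" by blast
  have hi: "coeff (q_poly n) k = 0" if "k > n" for k
    using deg that by (simp add: coeff_eq_0)
  have rec: "coeff (q_poly (Suc n)) (Suc k) = (real k + 2) * coeff (q_poly n) (Suc (Suc k))
      + (real k - (2 * real n + 3)) * coeff (q_poly n) k" for k
    unfolding q_poly_Suc_pderiv by (cases k) (simp_all add: coeff_pderiv algebra_simps)
  have "coeff (q_poly (Suc n)) k = 0" if "k > Suc n" for k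
    using that by (cases k) (simp_all add: rec hi del: q_poly.simps)
  then have "degree (q_poly (Suc n)) \<le> Suc n"
    by (intro degree_le) auto
  moreover have "coeff (q_poly (Suc n)) (Suc n) = - (real n + 3) * coeff (q_poly n) n"
    unfolding rec by (simp add: hi)
  ultimately show ?case
    using Suc by (simp add: field_simps)
qed

lemma degree_q_poly: "degree (q_poly n) = n"
  using q_poly_degree_coeff[of n] by (intro antisym le_degree) auto

text \<open>The top coefficient of the second summand of \<open>p\<^sub>n\<close> is \<open>-n / (n + 2)\<close> times that of the first,
  so they do not cancel.\<close>

lemma degree_p_poly: "degree (p_poly n) = n + 1"
proof (rule antisym)
  have deg: "degree ([:1, 0, 1:] * q_poly (n - 1)) \<le> 2 + (n - 1)"
    by (rule order.trans[OF degree_mult_le]) (simp add: degree_q_poly)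
  show "degree (p_poly n) \<le> n + 1"
  proof (cases n)
    case (Suc m)
    then show ?thesis
      unfolding p_poly_def using deg
      by (intro degree_add_le order.trans[OF degree_mult_le] order.trans[OF degree_smult_le])
        (simp_all add: degree_q_poly del: q_poly.simps)
  qed (simp add: p_poly_def)
  have "coeff (p_poly n) (n + 1) = (- 1) ^ n * fact (n + 1)"
  proof (cases n)
    case (Suc m)
    have "coeff (q_poly m) (Suc (Suc m)) = 0"
      by (simp add: coeff_eq_0 degree_q_poly)
    then have "coeff (p_poly n) (n + 1) = coeff (q_poly n) n + real n * coeff (q_poly m) m"
      using Suc by (simp add: p_poly_def del: q_poly.simps)
    also have "coeff (q_poly n) n = - (real m + 3) * ((- 1) ^ m * fact (m + 2) / 2)"
      using q_poly_degree_coeff[of n] Suc by (simp add: field_simps)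
    also have "coeff (q_poly m) m = (- 1) ^ m * fact (m + 2) / 2"
      using q_poly_degree_coeff[of m] by blast
    also have "- (real m + 3) * ((- 1) ^ m * fact (m + 2) / 2) + real n * ((- 1) ^ m * fact (m + 2) / 2)
        = (- 1) ^ n * fact (n + 1)"
      using Suc by (simp add: field_simps)
    finally show ?thesis .
  qed (simp add: p_poly_def)
  then show "n + 1 \<le> degree (p_poly n)"
    by (intro le_degree) simp
qed

section \<open>Positivity of the Turan determinant\<close>

definition turan :: "nat \<Rightarrow> real \<Rightarrow> real" where
  "turan n x = (real n + 1) * (poly (q_poly n) x)\<^sup>2
     - real n * poly (q_poly (n - 1)) x * poly (q_poly (Suc n)) x"

definition excess :: "nat \<Rightarrow> real \<Rightarrow> real" where
  "excess n x = (2 * real n + 1) * turan n x - (poly (q_poly n) x)\<^sup>2"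

text \<open>Both sides become quadratic forms in \<open>q\<^sub>n\<close> and \<open>q\<^sub>n\<^sub>+\<^sub>1\<close> once the recurrence is used
  upwards for \<open>q\<^sub>n\<^sub>+\<^sub>2\<close> and downwards for \<open>q\<^sub>n\<^sub>-\<^sub>1\<close>.\<close>

lemma excess_Suc:
  "(2 * real n + 1) * excess (Suc n) x = (real n + 1) * (1 + x\<^sup>2) *
     ((real n + 2) * (2 * real n + 5) * excess n x + 3 * (2 * real n + 3) * (poly (q_poly n) x)\<^sup>2)"
proof -
  define N s u v w z where defs: "N = real n" "s = 1 + x\<^sup>2" "u = poly (q_poly (n - 1)) x"
    "v = poly (q_poly n) x" "w = poly (q_poly (Suc n)) x" "z = poly (q_poly (Suc (Suc n))) x"
  have w: "(N + 2) * (s * N * u) = - (2 * N + 3) * x * v - w"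
    unfolding defs poly_q_poly_Suc by (simp add: algebra_simps)
  have z: "z = - (2 * N + 5) * x * w - (N + 1) * (N + 3) * s * v"
    unfolding defs poly_q_poly_Suc[of "Suc n"] by (simp add: algebra_simps)
  have "(N + 1) * s * ((N + 2) * (2 * N + 5) * ((2 * N + 1) * ((N + 1) * v\<^sup>2 - N * u * w) - v\<^sup>2)
        + 3 * (2 * N + 3) * v\<^sup>2)
    = (N + 1) * ((2 * N + 5) * ((N + 2) * ((2 * N + 1) * (N + 1) - 1) * s * v\<^sup>2
        - (2 * N + 1) * w * ((N + 2) * (s * N * u))) + 3 * (2 * N + 3) * s * v\<^sup>2)"
    by algebra
  also have "\<dots> = (2 * N + 1) * ((2 * N + 3) * ((N + 2) * w\<^sup>2 - (N + 1) * v * z) - w\<^sup>2)"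
    unfolding w z by algebra
  finally have "(2 * N + 1) * ((2 * N + 3) * ((N + 2) * w\<^sup>2 - (N + 1) * v * z) - w\<^sup>2)
    = (N + 1) * s * ((N + 2) * (2 * N + 5) * ((2 * N + 1) * ((N + 1) * v\<^sup>2 - N * u * w) - v\<^sup>2)
        + 3 * (2 * N + 3) * v\<^sup>2)"
    by (rule sym)
  then show ?thesis
    unfolding excess_def turan_def defs by (simp add: algebra_simps del: q_poly.simps)
qed

text \<open>The excess vanishes at index \<open>0\<close>; the square \<open>q\<^sub>0\<^sup>2 = 1\<close> in \<open>excess_Suc\<close> makes it positive at
  index \<open>1\<close>, and from there it stays positive.\<close>

lemma excess_pos: "excess (Suc n) x > 0"
proof (induction n)
  case 0
  have "1 + x\<^sup>2 > 0" by (simp add: add_pos_nonneg)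
  then show ?case
    using excess_Suc[of 0 x] by (simp add: excess_def[of 0] turan_def[of 0])
next
  case (Suc n)
  have "1 + x\<^sup>2 > 0" by (simp add: add_pos_nonneg)
  then have "(2 * real (Suc n) + 1) * excess (Suc (Suc n)) x > 0"
    unfolding excess_Suc[of "Suc n" x]
    by (intro mult_pos_pos add_pos_nonneg Suc.IH mult_nonneg_nonneg) auto
  then show ?case
    by (simp add: zero_less_mult_iff)
qed

lemma turan_pos: "turan n x > 0"
proof (cases n)
  case (Suc m)
  have "(2 * real n + 1) * turan n x > 0"
    using excess_pos[of m x] zero_le_power2[of "poly (q_poly (Suc m)) x"]
    unfolding excess_def Suc by linarith
  then show ?thesis
    by (simp add: zero_less_mult_iff)
qed (simp add: turan_def)

section \<open>The iterated derivatives\<close>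

lemma has_real_derivative_poly_times_powr:
  fixes p :: "real poly"
  shows "((\<lambda>x. poly p x * (1 + x\<^sup>2) powr (- (real n + 3 / 2))) has_real_derivative
     poly ([:1, 0, 1:] * pderiv p - smult (2 * real n + 3) ([:0, 1:] * p)) x
       * (1 + x\<^sup>2) powr (- (real (Suc n) + 3 / 2))) (at x)"
proof -
  have s: "1 + x\<^sup>2 > 0" by (simp add: add_pos_nonneg)
  define e where "e = - (real (Suc n) + 3 / 2)"
  have step: "(1 + x\<^sup>2) powr (- (real n + 3 / 2)) = (1 + x\<^sup>2) * (1 + x\<^sup>2) powr e"
    using powr_mult_base[of "1 + x\<^sup>2" e] by (simp add: e_def algebra_simps)
  have "((\<lambda>x. poly p x * (1 + x\<^sup>2) powr (- (real n + 3 / 2))) has_real_derivative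
     poly (pderiv p) x * (1 + x\<^sup>2) powr (- (real n + 3 / 2))
      + - (real n + 3 / 2) * (1 + x\<^sup>2) powr e * (2 * x) * poly p x) (at x)"
    using s by (auto intro!: derivative_eq_intros simp: e_def algebra_simps)
  then show ?thesis
    unfolding step e_def[symmetric] by (simp add: power2_eq_square algebra_simps)
qed

lemma B_eq: "B n x = poly (q_poly n) x * (1 + x\<^sup>2) powr (- (real n + 3 / 2))"
proof (induction n arbitrary: x)
  case 0
  then show ?case
    by (simp add: B_def powr_minus_divide add.commute)
next
  case (Suc n)
  have "B (Suc n) x = deriv (B n) x"
    by (simp add: B_def)
  also have "B n = (\<lambda>x. poly (q_poly n) x * (1 + x\<^sup>2) powr (- (real n + 3 / 2)))"
    using Suc by blast
  also have "deriv \<dots> x = poly (q_poly (Suc n)) x * (1 + x\<^sup>2) powr (- (real (Suc n) + 3 / 2))"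
    unfolding q_poly_Suc_pderiv by (rule DERIV_imp_deriv[OF has_real_derivative_poly_times_powr])
  finally show ?case .
qed

lemma B_has_derivative: "(B n has_real_derivative B (Suc n) x) (at x)"
proof -
  have "B n = (\<lambda>x. poly (q_poly n) x * (1 + x\<^sup>2) powr (- (real n + 3 / 2)))"
    using B_eq by blast
  then show ?thesis
    unfolding B_eq[of "Suc n"] q_poly_Suc_pderiv
    using has_real_derivative_poly_times_powr[of "q_poly n" n x] by simp
qed

lemma x_times_B_has_derivative:
  "((\<lambda>x. x * B n x + real n * B (n - 1) x) has_real_derivative
     x * B (Suc n) x + real (Suc n) * B n x) (at x)"
proof (cases n)
  case 0
  then show ?thesis
    by (auto intro!: derivative_eq_intros B_has_derivative)
next
  case (Suc m)
  then show ?thesis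
    by (auto intro!: derivative_eq_intros B_has_derivative simp: algebra_simps)
qed

text \<open>Leibniz' rule for the product of \<open>x\<close> and \<open>B\<^sub>0\<close>.\<close>

lemma A_eq: "A n x = x * B n x + real n * B (n - 1) x"
proof (induction n arbitrary: x)
  case 0
  then show ?case by (simp add: A_def B_def)
next
  case (Suc n)
  have "A (Suc n) x = deriv (A n) x"
    by (simp add: A_def)
  also have "A n = (\<lambda>x. x * B n x + real n * B (n - 1) x)"
    using Suc by blast
  also have "deriv \<dots> x = x * B (Suc n) x + real (Suc n) * B n x"
    by (rule DERIV_imp_deriv[OF x_times_B_has_derivative])
  finally show ?case by simp
qed

lemma A_has_derivative: "(A n has_real_derivative A (Suc n) x) (at x)"
proof -
  have "A n = (\<lambda>x. x * B n x + real n * B (n - 1) x)"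
    using A_eq by blast
  then show ?thesis
    using x_times_B_has_derivative[of n x] by (simp add: A_eq[of "Suc n"])
qed

lemma A_eq_p_poly: "A n x = poly (p_poly n) x * (1 + x\<^sup>2) powr (- (real n + 3 / 2))"
proof (cases n)
  case (Suc m)
  have "1 + x\<^sup>2 > 0" by (simp add: add_pos_nonneg)
  then have "(1 + x\<^sup>2) powr (- (real m + 3 / 2)) = (1 + x\<^sup>2) * (1 + x\<^sup>2) powr (- (real n + 3 / 2))"
    using powr_mult_base[of "1 + x\<^sup>2" "- (real n + 3 / 2)"] Suc by (simp add: algebra_simps)
  then show ?thesis
    using Suc by (simp add: A_eq B_eq p_poly_def power2_eq_square algebra_simps del: q_poly.simps)
qed (simp add: A_eq B_eq p_poly_def)

text \<open>The Leibniz form cancels the terms with a factor \<open>x\<close>; the two remaining products carry the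
  same power of \<open>1 + x\<^sup>2\<close>, since \<open>(n - 1) + (n + 1) = 2n\<close>.\<close>

lemma Wronskian_A_B_pos: "A (Suc n) x * B n x - A n x * B (Suc n) x > 0"
proof -
  have s: "1 + x\<^sup>2 > 0" by (simp add: add_pos_nonneg)
  define e where "e = (1 + x\<^sup>2) powr (- (2 * real n + 3))"
  have "((1 + x\<^sup>2) powr (- (real n + 3 / 2)))\<^sup>2 = e"
    unfolding e_def power2_eq_square[of "_ powr _"] powr_add[symmetric] by simp
  then have sq: "(B n x)\<^sup>2 = e * (poly (q_poly n) x)\<^sup>2"
    by (simp add: B_eq power_mult_distrib)
  have prod: "real n * B (n - 1) x * B (Suc n) x
      = e * (real n * poly (q_poly (n - 1)) x * poly (q_poly (Suc n)) x)"
  proof (cases n)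
    case (Suc m)
    have "(1 + x\<^sup>2) powr (- (real m + 3 / 2)) * (1 + x\<^sup>2) powr (- (real (Suc n) + 3 / 2)) = e"
      using Suc by (simp add: e_def powr_add[symmetric])
    then show ?thesis
      using Suc unfolding B_eq by (simp add: algebra_simps del: q_poly.simps)
  qed simp
  have "A (Suc n) x * B n x - A n x * B (Suc n) x
      = (real n + 1) * (B n x)\<^sup>2 - real n * B (n - 1) x * B (Suc n) x"
    by (simp add: A_eq power2_eq_square algebra_simps)
  also have "\<dots> = e * turan n x"
    unfolding sq prod turan_def by (simp add: algebra_simps del: q_poly.simps)
  finally show ?thesis
    using s turan_pos[of n x] by (simp add: e_def)
qed

section \<open>Interlacing\<close>

theorem proposition4p6:
  fixes L :: nat
  assumes "L \<ge> 1"
  shows "strictly_interlace (A L) (B L) \<and>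
    (\<exists>p q :: real poly.
       (\<forall>x. poly p x = P L x) \<and> (\<forall>x. poly q x = Q L x) \<and>
       degree p = L + 1 \<and> degree q = L \<and>
       strictly_interlace (poly p) (poly q))"
proof -
  have s: "1 + x\<^sup>2 > 0" for x :: real
    by (simp add: add_pos_nonneg)
  have AB: "strictly_interlace (A L) (B L)"
    using A_has_derivative B_has_derivative Wronskian_A_B_pos
    by (intro strictly_interlace_if_Wronskian_nonzero[where f' = "A (Suc L)" and g' = "B (Suc L)"])
      (auto simp: less_imp_neq[symmetric] dest: less_imp_neq)
  have cancel: "(1 + x\<^sup>2) powr ((2 * real L + 3) / 2) * (c * (1 + x\<^sup>2) powr (- (real L + 3 / 2))) = c"
    for x c :: real
  proof -
    have half: "(2 * real L + 3) / 2 = real L + 3 / 2" by simp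
    show ?thesis
      unfolding half powr_minus using s[of x] by simp
  qed
  have p: "poly (p_poly L) x = P L x" for x
    using cancel by (simp add: P_def A_eq_p_poly)
  have q: "poly (q_poly L) x = Q L x" for x
    using cancel by (simp add: Q_def B_eq)
  have "strictly_interlace (poly (p_poly L)) (poly (q_poly L))"
    using AB strictly_interlace_cong_zeros[of "A L" "poly (p_poly L)" "B L" "poly (q_poly L)"]
      less_imp_neq[OF s, symmetric]
    by (simp add: A_eq_p_poly B_eq)
  with AB p q degree_p_poly degree_q_poly show ?thesis
    by blast
qed

end
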